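(* $ms((2,2)) = 5$.
   Context: A graph-like scheduling problem on $n$ elements is a Boolean formula $\mathbf{S} = \bigwedge_{\alpha \in J} \mathbf{C}_\alpha$ ($J$ finite) where each clause is a disjunction $\mathbf{C} = \bigvee_{(i,j)\in I} (x_i \neq x_j)$ with $i,j \in [n]=\{1,\dots,n\}$ and $i \neq j$ for $(i,j)\in I$. Its size is $|\mathbf{S}| = |J|$. A solution is an assignment of a nonnegative integer to each $x_i$ making $\mathbf{S}$ true. $\mathbf{S}$ has property B if it has a solution in which each $x_i$, $i\in[n]$, is assigned $0$ or $1$. For a clause $\mathbf{C} = \bigvee_{(i,j)\in I} (x_i \neq x_j)$, $G_{\mathbf{C}}$ is the graph with vertex set $V_{\mathbf{C}} = \{i : (i,j)\in I \text{ or } (j,i)\in I \text{ for some } j\}$ and edge set $\{ij : (i,j)\in I\}$, and $\lambda(\mathbf{C})$ is the integer partition of $|V_{\mathbf{C}}|$ given by the sizes of the connected components of $G_{\mathbf{C}}$. Two clauses whose graphs have the same connected components (same vertex sets of components) are logically equivalent and are identified. Integer partitions are weakly decreasing finite sequences of positive integers. $\mathbf{S}$ is $\lambda$-uniform if $\lambda(\mathbf{C}_\alpha)=\lambda$ for every $\alpha\in J$. (So in a $(2,2)$-uniform problem each clause is, up to equivalence, $(x_i\neq x_j)\vee(x_k\neq x_l)$ with $i,j,k,l$ distinct.) For a partition $\lambda$ with no part equal to $1$, $ms(\lambda)$ is the minimum possible size of a $\lambda$-uniform graph-like scheduling problem (on any number $n$ of elements) that does not have property B. *)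

theory Defs
  imports "HOL-Library.Multiset"
begin

text \<open>
  A clause is represented by its index set \<open>I\<close> and stands for the disjunction of the
  formulas \<open>x i \<noteq> x j\<close> over \<open>(i, j) \<in> I\<close>.  A problem is a finite family of clauses, given
  as a list, so that its size is the length of the list.  Different index sets may give
  graphs with the same components, and hence equivalent clauses; a family may
  repeat a clause, up to equivalence or literally, and every member counts towards the size.
  Discarding repetitions changes neither the solutions nor uniformity, so the
  minimum size below is the same whether or not equivalent clauses are identified.
\<close>

type_synonym clause = "(nat \<times> nat) set"
type_synonym problem = "clause list"

definition is_clause :: "nat \<Rightarrow> clause \<Rightarrow> bool" where
  "is_clause n I \<longleftrightarrow> (\<forall>(i, j) \<in> I. i \<in> {1..n} \<and> j \<in> {1..n} \<and> i \<noteq> j)"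

definition graph_like_problem :: "nat \<Rightarrow> problem \<Rightarrow> bool" where
  "graph_like_problem n S \<longleftrightarrow> (\<forall>C \<in> set S. is_clause n C)"

definition clause_holds :: "(nat \<Rightarrow> nat) \<Rightarrow> clause \<Rightarrow> bool" where
  "clause_holds x I \<longleftrightarrow> (\<exists>(i, j) \<in> I. x i \<noteq> x j)"

definition is_solution :: "problem \<Rightarrow> (nat \<Rightarrow> nat) \<Rightarrow> bool" where
  "is_solution S x \<longleftrightarrow> (\<forall>C \<in> set S. clause_holds x C)"

definition property_B :: "nat \<Rightarrow> problem \<Rightarrow> bool" where
  "property_B n S \<longleftrightarrow> (\<exists>x. is_solution S x \<and> (\<forall>i \<in> {1..n}. x i \<in> {0, 1}))"

definition clause_verts :: "clause \<Rightarrow> nat set" where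
  "clause_verts I = {i. \<exists>j. (i, j) \<in> I \<or> (j, i) \<in> I}"

definition clause_edges :: "clause \<Rightarrow> nat set set" where
  "clause_edges I = {{i, j} | i j. (i, j) \<in> I}"

definition components :: "'a set \<Rightarrow> 'a set set \<Rightarrow> 'a set set" where
  "components V E = V // ({(u, v). {u, v} \<in> E}\<^sup>* \<inter> V \<times> V)"

text \<open>Integer partitions are weakly decreasing lists of positive integers.\<close>

definition clause_partition :: "clause \<Rightarrow> nat list" where
  "clause_partition I =
     rev (sorted_list_of_multiset
       (image_mset card (mset_set (components (clause_verts I) (clause_edges I)))))"

definition uniform :: "nat list \<Rightarrow> problem \<Rightarrow> bool" where
  "uniform lam S \<longleftrightarrow> (\<forall>C \<in> set S. clause_partition C = lam)"

text \<open>
  Meaningful for partitions without parts equal to \<open>1\<close>; when no problem qualifies,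
  the value is unspecified.
\<close>

definition ms :: "nat list \<Rightarrow> nat" where
  "ms lam = (LEAST m. \<exists>n S. graph_like_problem n S \<and> uniform lam S
                          \<and> \<not> property_B n S \<and> length S = m)"

end

theory Submission
  imports Defs
begin

text \<open>
  For the lower bound, colour the elements with \<open>0\<close> and \<open>1\<close> uniformly at random.  A clause fails
  exactly if each of its components is monochromatic, so a clause of type \<open>(2,2)\<close> fails with
  probability \<open>1/4\<close>, and four such clauses have on average one failure.  A constant colouring
  makes all of them fail at once, which is above average; hence some colouring
  is below average, and it makes no clause fail.  The lemma \<open>card_failing_sets_le\<close> is the
  probability estimate, and \<open>property_B_if_few_clauses\<close> is the averaging.

  For the upper bound, the ten edges of the complete graph on five vertices split into five
  pairs of disjoint edges, the pair number \<open>v\<close> avoiding exactly the vertex \<open>v\<close>.  A colouring with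
  two colours has a colour class with at most two elements.  If this class is empty, all
  clauses fail; if it is \<open>{v}\<close>, the clause that avoids \<open>v\<close> fails; if it is \<open>{u, v}\<close>, the clause
  that contains the edge \<open>uv\<close> fails, since its other edge lies in the complementary class.
\<close>

section \<open>Components of a clause\<close>

abbreviation adjacency :: "clause \<Rightarrow> (nat \<times> nat) set" where
  "adjacency C \<equiv> {(u, v). {u, v} \<in> clause_edges C}"

lemma adjacency_eq: "adjacency C = C \<union> C\<inverse>"
  by (auto simp: clause_edges_def doubleton_eq_iff)

lemma failing_clause_constant_on_paths:
  assumes "\<not> clause_holds x C" and "(u, v) \<in> (adjacency C)\<^sup>*"
  shows "x u = x v"
  using assms(2)
proof (induction rule: rtrancl_induct)
  case (step v w)
  then show ?case using assms(1) by (auto simp: adjacency_eq clause_holds_def)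
qed simp

lemma equiv_connectedness:
  "equiv V ({(u, v). {u, v} \<in> E}\<^sup>* \<inter> V \<times> V)" (is "equiv V (?R\<^sup>* \<inter> _)")
proof (rule equivI)
  have "sym ?R" by (auto simp: sym_def insert_commute)
  then show "sym (?R\<^sup>* \<inter> V \<times> V)"
    by (blast intro: symI dest: symD[OF sym_rtrancl])
  show "trans (?R\<^sup>* \<inter> V \<times> V)" by (auto simp: trans_def)
qed (auto simp: refl_on_def)

text \<open>
  The components of the clause are \<open>{a, b}\<close> and \<open>{c, d}\<close>.  The conclusion presents \<open>a\<close> and \<open>c\<close>
  as vertices that are connected to vertices outside \<open>{a, c}\<close>, so that in a failing colouring
  the colours of \<open>a\<close> and \<open>c\<close> are determined by the other colours.
\<close>

lemma clause_type_2_2E: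
  assumes "clause_partition C = [2, 2]"
  obtains a b c d where "a \<in> clause_verts C" "c \<in> clause_verts C"
    "a \<noteq> c" "b \<notin> {a, c}" "d \<notin> {a, c}"
    "(a, b) \<in> (adjacency C)\<^sup>*" "(c, d) \<in> (adjacency C)\<^sup>*"
proof -
  let ?V = "clause_verts C"
  let ?R = "(adjacency C)\<^sup>* \<inter> ?V \<times> ?V"
  let ?K = "components ?V (clause_edges C)"
  have eq: "equiv ?V ?R" by (rule equiv_connectedness)
  have K: "?K = ?V // ?R" by (simp add: components_def)
  have "sorted_list_of_multiset (image_mset card (mset_set ?K)) = [2, 2]"
    using assms by (simp add: clause_partition_def rev_eq_Cons_iff)
  from arg_cong[OF this, of mset] have m: "image_mset card (mset_set ?K) = {#2, 2#}"
    by simp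
  \<comment> \<open>\<open>mset_set\<close> maps infinite sets to the empty multiset\<close>
  have fin: "finite ?K" by (rule ccontr) (use m in simp)
  have "card ?K = 2" using arg_cong[OF m, of size] by simp
  then obtain X Y where XY: "?K = {X, Y}" "X \<noteq> Y" by (auto simp: card_2_iff)
  have "card ` ?K = {2}" using arg_cong[OF m, of set_mset] fin by simp
  then have "card X = 2" "card Y = 2" using XY by auto
  then obtain a b c d where ab: "X = {a, b}" "a \<noteq> b" and cd: "Y = {c, d}" "c \<noteq> d"
    by (auto simp: card_2_iff)
  have quot: "X \<in> ?V // ?R" "Y \<in> ?V // ?R" using XY K by auto
  have disj: "X \<inter> Y = {}" using quotient_disj[OF eq quot] XY(2) by auto
  have "(a, b) \<in> ?R" "(c, d) \<in> ?R"
    using in_quotient_imp_in_rel[OF eq quot(1)] in_quotient_imp_in_rel[OF eq quot(2)] ab cd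
    by (meson insert_subset subset_refl)+
  then show thesis using that[of a c b d] disj ab cd by blast
qed

text \<open>
  The two edges are not joined by a path, because the colouring with \<open>1\<close> on \<open>{a, b}\<close> and \<open>0\<close>
  elsewhere makes the clause fail, and is therefore constant on paths.
\<close>

lemma components_two_edges:
  assumes "distinct [a, b, c, d]"
  shows "components {a, b, c, d} (clause_edges {(a, b), (c, d)}) = {{a, b}, {c, d}}"
proof -
  let ?C = "{(a, b), (c, d)}"
  let ?V = "{a, b, c, d}"
  define R where "R = (adjacency ?C)\<^sup>* \<inter> ?V \<times> ?V"
  have "\<not> clause_holds (\<lambda>i. of_bool (i \<in> {a, b})) ?C"
    using assms by (simp add: clause_holds_def)
  from failing_clause_constant_on_paths[OF this]
  have sep: "u \<in> {a, b} \<longleftrightarrow> v \<in> {a, b}" if "(u, v) \<in> R" for u v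
    using that unfolding R_def of_bool_eq_iff by blast
  have reach: "(a, b) \<in> R" "(b, a) \<in> R" "(c, d) \<in> R" "(d, c) \<in> R"
    unfolding R_def by (simp_all add: adjacency_eq r_into_rtrancl)
  have refl: "(u, u) \<in> R" if "u \<in> ?V" for u using that unfolding R_def by blast
  have range: "v \<in> ?V" if "(u, v) \<in> R" for u v using that unfolding R_def by blast
  have ne: "c \<notin> {a, b}" "d \<notin> {a, b}" using assms by auto
  have "R `` {u} = {a, b}" if "u \<in> {a, b}" for u
    using sep[of u] reach refl[of u] that by blast
  moreover have "R `` {u} = {c, d}" if "u \<in> {c, d}" for u
    using sep[of u] range[of u] reach refl[of u] ne that by blast
  ultimately have "R `` {a} = {a, b}" "R `` {b} = {a, b}" "R `` {c} = {c, d}" "R `` {d} = {c, d}"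
    by simp_all
  then have "?V // R = {{a, b}, {c, d}}" by (simp add: quotient_def insert_commute)
  then show ?thesis unfolding components_def R_def .
qed

lemma clause_partition_two_edges:
  assumes "distinct [a, b, c, d]"
  shows "clause_partition {(a, b), (c, d)} = [2, 2]"
proof -
  have V: "clause_verts {(a, b), (c, d)} = {a, b, c, d}" by (auto simp: clause_verts_def)
  have "{a, b} \<noteq> {c, d}" using assms by auto
  then show ?thesis
    using assms by (simp add: clause_partition_def V components_two_edges)
qed

section \<open>Few clauses always leave a good colouring\<close>

text \<open>A colouring of \<open>{1..n}\<close> with two colours is encoded by the set of elements coloured \<open>1\<close>.\<close>

definition failing_sets :: "nat \<Rightarrow> clause \<Rightarrow> nat set set" where
  "failing_sets n C = {A \<in> Pow {1..n}. \<not> clause_holds (\<lambda>i. of_bool (i \<in> A)) C}"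

lemma finite_failing_sets: "finite (failing_sets n C)"
  by (simp add: failing_sets_def)

lemma empty_in_failing_sets: "{} \<in> failing_sets n C"
  by (simp add: failing_sets_def clause_holds_def)

text \<open>
  A random colouring makes the clause fail with probability at most \<open>1 / 2 ^ card T\<close>.  Indeed,
  if the colours in a subset \<open>X\<close> of \<open>T\<close> are switched in a failing colouring, then both can be
  recovered from the result: an element of \<open>T\<close> was switched iff its colour now differs
  from that of a connected element outside \<open>T\<close>.
\<close>

lemma card_failing_sets_le:
  assumes "T \<subseteq> {1..n}"
    and conn: "\<And>t. t \<in> T \<Longrightarrow> \<exists>r. r \<notin> T \<and> (t, r) \<in> (adjacency C)\<^sup>*"
  shows "card (failing_sets n C) * 2 ^ card T \<le> 2 ^ n"
proof -
  let ?F = "failing_sets n C"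
  let ?switch = "\<lambda>(A, X). sym_diff A X"
  have agree: "t \<in> A \<longleftrightarrow> r \<in> A" if "A \<in> ?F" "(t, r) \<in> (adjacency C)\<^sup>*" for A t r
  proof -
    have "\<not> clause_holds (\<lambda>i. of_bool (i \<in> A)) C" using that(1) by (simp add: failing_sets_def)
    from failing_clause_constant_on_paths[OF this that(2)] show ?thesis
      by (simp only: of_bool_eq_iff)
  qed
  have inj: "inj_on ?switch (?F \<times> Pow T)"
  proof (rule inj_onI, clarify)
    fix A X B Y
    assume AX: "A \<in> ?F" "X \<subseteq> T" and BY: "B \<in> ?F" "Y \<subseteq> T"
      and eq: "sym_diff A X = sym_diff B Y"
    have "t \<in> X \<longleftrightarrow> t \<in> Y" if "t \<in> T" for t
    proof -
      obtain r where r: "r \<notin> T" "(t, r) \<in> (adjacency C)\<^sup>*" using conn that by blast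
      have "t \<in> A \<longleftrightarrow> r \<in> A" "t \<in> B \<longleftrightarrow> r \<in> B" "r \<notin> X" "r \<notin> Y"
        using agree[OF AX(1) r(2)] agree[OF BY(1) r(2)] AX(2) BY(2) r(1) by auto
      then show ?thesis using eq by blast
    qed
    then have "X = Y" using AX(2) BY(2) by blast
    then show "A = B \<and> X = Y" using eq by blast
  qed
  have "finite T" using assms(1) finite_subset by blast
  then have "card ?F * 2 ^ card T = card (?F \<times> Pow T)"
    by (simp add: card_cartesian_product card_Pow)
  also have "\<dots> \<le> card (Pow {1..n})"
    using inj by (rule card_inj_on_le) (use assms(1) in \<open>auto simp: failing_sets_def\<close>)
  finally show ?thesis by (simp add: card_Pow)
qed

text \<open>
  On average at most one clause fails.  The empty set makes all clauses fail; removing it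
  from each family of failing sets and counting it once lowers the union bound from \<open>2 ^ n\<close> to
  \<open>2 ^ n - 2 ^ k + 1\<close>, which is smaller than the number of colourings since \<open>k > 0\<close>.
\<close>

lemma property_B_if_few_clauses:
  assumes "k > 0" and len: "length S \<le> 2 ^ k"
    and bound: "\<And>C. C \<in> set S \<Longrightarrow> card (failing_sets n C) * 2 ^ k \<le> 2 ^ n"
  shows "property_B n S"
proof (cases "S = []")
  case True
  then show ?thesis by (auto simp: property_B_def is_solution_def intro!: exI[of _ "\<lambda>_. 0"])
next
  case False
  let ?F = "failing_sets n"
  let ?U = "\<Union>C\<in>set S. ?F C - {{}}"
  have pos: "card (?F C) \<ge> 1" for C
    using empty_in_failing_sets[of n C] finite_failing_sets[of n C]
    by (metis One_nat_def Suc_leI card_gt_0_iff empty_iff)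
  have "\<exists>C. C \<in> set S" using False by (cases S) auto
  then obtain C where C: "C \<in> set S" ..
  have "(2::nat) ^ k \<le> card (?F C) * 2 ^ k" using pos[of C] by simp
  then have kn: "(2::nat) ^ k \<le> 2 ^ n" using bound[OF C] by linarith
  have k2: "(2::nat) \<le> 2 ^ k" using \<open>k > 0\<close> by (simp add: self_le_power)
  have each: "card (?F C - {{}}) * 2 ^ k \<le> 2 ^ n - 2 ^ k" if "C \<in> set S" for C
    using bound[OF that]
    by (simp add: card_Diff_singleton empty_in_failing_sets diff_mult_distrib)
  have "card ?U * 2 ^ k \<le> (\<Sum>C\<in>set S. card (?F C - {{}})) * 2 ^ k"
    by (intro mult_right_mono card_UN_le) auto
  also have "\<dots> = (\<Sum>C\<in>set S. card (?F C - {{}}) * 2 ^ k)"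
    by (rule sum_distrib_right)
  also have "\<dots> \<le> (\<Sum>C\<in>set S. 2 ^ n - 2 ^ k)" by (rule sum_mono) (rule each)
  also have "\<dots> = card (set S) * (2 ^ n - 2 ^ k)" by simp
  also have "\<dots> \<le> 2 ^ k * (2 ^ n - 2 ^ k)"
    using card_length[of S] len by (intro mult_right_mono) auto
  finally have "card ?U \<le> 2 ^ n - 2 ^ k" by (simp add: mult.commute)
  moreover have "card (insert {} ?U) \<le> Suc (card ?U)" by (rule card_insert_le_m1) simp_all
  moreover have "card (Pow {1..n}) = 2 ^ n" by (simp add: card_Pow)
  ultimately have "card (insert {} ?U) < card (Pow {1..n})"
    using kn k2 by linarith
  moreover have "finite (insert {} ?U)" by (simp add: finite_failing_sets)
  ultimately have "\<not> Pow {1..n} \<subseteq> insert {} ?U"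
    using card_mono by (metis not_less)
  then obtain A where A: "A \<subseteq> {1..n}" "A \<noteq> {}" "\<And>C. C \<in> set S \<Longrightarrow> A \<notin> ?F C" by auto
  then have "is_solution S (\<lambda>i. of_bool (i \<in> A))"
    by (auto simp: is_solution_def failing_sets_def)
  then show ?thesis unfolding property_B_def by (intro exI[of _ "\<lambda>i. of_bool (i \<in> A)"]) auto
qed

lemma property_B_if_at_most_four_2_2_clauses:
  assumes S: "graph_like_problem n S" "uniform [2, 2] S" and "length S \<le> 4"
  shows "property_B n S"
proof (rule property_B_if_few_clauses[of 2])
  fix C assume C: "C \<in> set S"
  then have "clause_partition C = [2, 2]" using S(2) by (simp add: uniform_def)
  then obtain a b c d where
    v: "a \<in> clause_verts C" "c \<in> clause_verts C" "a \<noteq> c" "b \<notin> {a, c}" "d \<notin> {a, c}"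
      "(a, b) \<in> (adjacency C)\<^sup>*" "(c, d) \<in> (adjacency C)\<^sup>*"
    by (rule clause_type_2_2E)
  have "clause_verts C \<subseteq> {1..n}"
    using S(1) C by (fastforce simp: graph_like_problem_def is_clause_def clause_verts_def)
  then have "card (failing_sets n C) * 2 ^ card {a, c} \<le> 2 ^ n"
    using v by (intro card_failing_sets_le) auto
  then show "card (failing_sets n C) * 2\<^sup>2 \<le> 2 ^ n" using v(3) by simp
qed (use assms(3) in auto)

section \<open>Five clauses without property B\<close>

text \<open>
  Placing \<open>1, \<dots>, 5\<close> on a circle, the clause that avoids \<open>v\<close> joins the two neighbours of \<open>v\<close>,
  and the two elements opposite to \<open>v\<close>.  The clauses are listed for \<open>v = 1, \<dots>, 5\<close>.
\<close>

definition pentagon_problem :: problem where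
  "pentagon_problem =
     [{(2, 5), (3, 4)}, {(1, 3), (4, 5)}, {(2, 4), (1, 5)}, {(3, 5), (1, 2)}, {(1, 4), (2, 3)}]"

lemma graph_like_pentagon_problem: "graph_like_problem 5 pentagon_problem"
  by (simp add: pentagon_problem_def graph_like_problem_def is_clause_def)

lemma uniform_pentagon_problem: "uniform [2, 2] pentagon_problem"
  by (simp add: pentagon_problem_def uniform_def clause_partition_two_edges)

lemma not_property_B_pentagon_problem: "\<not> property_B 5 pentagon_problem"
proof
  assume "property_B 5 pentagon_problem"
  then obtain x where x: "is_solution pentagon_problem x" "\<forall>i \<in> {1..5}. x i \<in> {0, 1}"
    unfolding property_B_def by blast
  have "x 1 \<in> {0, 1}" "x 2 \<in> {0, 1}" "x 3 \<in> {0, 1}" "x 4 \<in> {0, 1}" "x 5 \<in> {0, 1}"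
    using x(2) by simp_all
  moreover have "x 2 \<noteq> x 5 \<or> x 3 \<noteq> x 4" "x 1 \<noteq> x 3 \<or> x 4 \<noteq> x 5" "x 2 \<noteq> x 4 \<or> x 1 \<noteq> x 5"
    "x 3 \<noteq> x 5 \<or> x 1 \<noteq> x 2" "x 1 \<noteq> x 4 \<or> x 2 \<noteq> x 3"
    using x(1) by (simp_all add: is_solution_def pentagon_problem_def clause_holds_def)
  ultimately show False
    by (elim insertE emptyE) simp_all
qed

theorem lemma2p10:
  shows "ms [2, 2] = 5"
  unfolding ms_def
proof (rule Least_equality)
  have "length pentagon_problem = 5" by (simp add: pentagon_problem_def)
  then show "\<exists>n S. graph_like_problem n S \<and> uniform [2, 2] S \<and> \<not> property_B n S \<and> length S = 5"
    using graph_like_pentagon_problem uniform_pentagon_problem not_property_B_pentagon_problem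
    by blast
next
  fix m
  assume "\<exists>n S. graph_like_problem n S \<and> uniform [2, 2] S \<and> \<not> property_B n S \<and> length S = m"
  then have "\<not> m \<le> 4" using property_B_if_at_most_four_2_2_clauses by blast
  then show "5 \<le> m" by simp
qed

end
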